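(* There exists an absolute constant $C>0$ such that for all integers $k\ge 2$ and $d\ge1$, the price of explainability $\rho_{k,d}$ of the $k$-medians problem in $\mathbb{R}^d$ satisfies $\rho_{k,d}\le C\,d\log k$.
   Context: An instance of the $k$-medians problem is a finite set $X\subset\mathbb{R}^d$ of $n\ge k$ points, with $k\ge2$. A $k$-clustering is a partition $\mathcal{C}=(C_1,\dots,C_k)$ of $X$ into $k$ groups together with a representative $\mu(C_i)\in\mathbb{R}^d$ for each group; its cost is $cost(\mathcal{C})=\sum_{i=1}^k\sum_{x\in C_i}\|x-\mu(C_i)\|_1$. A standard decision tree is a binary tree in which each internal node $v$ is associated with a cut $(i_v,\theta_v)$, $i_v\in\{1,\dots,d\}$, $\theta_v\in\mathbb{R}$; the points reaching $v$ with $i_v$-th coordinate $\le\theta_v$ go to one child and those with $i_v$-th coordinate $>\theta_v$ go to the other. A $k$-clustering is explainable if its partition is the one induced on $X$ by the leaves of a standard decision tree with $k$ leaves (representatives may be arbitrary points of $\mathbb{R}^d$). $OPT_{unr}(X)$ is the minimum cost over all $k$-clusterings of $X$, $OPT_{exp}(X)$ is the minimum cost over all explainable $k$-clusterings of $X$. The price of explainability is $\rho_{k,d}=\sup_X OPT_{exp}(X)/OPT_{unr}(X)$, over all instances $X\subset\mathbb{R}^d$ with $OPT_{unr}(X)>0$. *)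

theory Defs
  imports Complex_Main "HOL-Library.FuncSet" "HOL-Library.Disjoint_Sets"
    "HOL-Library.Extended_Real" "HOL-Library.Tree"
begin

text \<open>
  The dimension is quantified inside the theorem, so it is a natural number rather than a type:
  a point of \<open>\<real>\<^sup>d\<close> is a function on \<open>{..<d}\<close> (coordinates are counted from 0), made
  extensional outside so that equality of functions is equality of points.
\<close>

type_synonym point = "nat \<Rightarrow> real"

definition euclid :: "nat \<Rightarrow> point set" where
  "euclid d = {..<d} \<rightarrow>\<^sub>E UNIV"

definition l1_dist :: "nat \<Rightarrow> point \<Rightarrow> point \<Rightarrow> real" where
  "l1_dist d x y = (\<Sum>i<d. \<bar>x i - y i\<bar>)"

definition kmedians_instance :: "nat \<Rightarrow> nat \<Rightarrow> point set \<Rightarrow> bool" where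
  "kmedians_instance k d X \<longleftrightarrow> finite X \<and> X \<subseteq> euclid d \<and> k \<le> card X"

text \<open>
  The groups of a clustering are the (nonempty, hence pairwise different) parts of a partition,
  so they need no indices; \<open>\<mu>\<close> assigns a representative to each of them.
\<close>

definition clusterings :: "nat \<Rightarrow> nat \<Rightarrow> point set \<Rightarrow> (point set set \<times> (point set \<Rightarrow> point)) set" where
  "clusterings k d X = {(P, \<mu>). partition_on X P \<and> card P = k \<and> \<mu> \<in> P \<rightarrow> euclid d}"

definition cost :: "nat \<Rightarrow> point set set \<times> (point set \<Rightarrow> point) \<Rightarrow> real" where
  "cost d = (\<lambda>(P, \<mu>). \<Sum>A\<in>P. \<Sum>x\<in>A. l1_dist d x (\<mu> A))"

text \<open>
  Inner nodes carry the cuts. Which of the two children receives the points below the threshold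
  is immaterial, as only the family of leaf cells matters; it is the left one here.
\<close>

type_synonym decision_tree = "(nat \<times> real) tree"

definition cuts_in_dim :: "nat \<Rightarrow> decision_tree \<Rightarrow> bool" where
  "cuts_in_dim d t \<longleftrightarrow> (\<forall>(i, \<theta>)\<in>set_tree t. i < d)"

fun leaf_cells :: "decision_tree \<Rightarrow> point set \<Rightarrow> point set set" where
  "leaf_cells Leaf X = {X}"
| "leaf_cells (Node l (i, \<theta>) r) X =
     leaf_cells l {x \<in> X. x i \<le> \<theta>} \<union> leaf_cells r {x \<in> X. x i > \<theta>}"

text \<open>
  \<open>size1\<close> is the number of leaves of a binary tree. When \<open>P\<close> is a partition of \<open>X\<close> into \<open>k\<close> parts,
  no two of the \<open>k\<close> leaves have the same cell and no cell is empty.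
\<close>

definition explainable :: "nat \<Rightarrow> nat \<Rightarrow> point set \<Rightarrow> point set set \<Rightarrow> bool" where
  "explainable k d X P \<longleftrightarrow> (\<exists>t. cuts_in_dim d t \<and> size1 t = k \<and> P = leaf_cells t X)"

text \<open>
  Optimal costs are infima in the extended reals, where no side condition (nonemptiness,
  boundedness) is needed for infima and suprema to have their usual meaning.
\<close>

definition opt_unr :: "nat \<Rightarrow> nat \<Rightarrow> point set \<Rightarrow> ereal" where
  "opt_unr k d X = (INF c\<in>clusterings k d X. ereal (cost d c))"

definition opt_exp :: "nat \<Rightarrow> nat \<Rightarrow> point set \<Rightarrow> ereal" where
  "opt_exp k d X =
     (INF c\<in>{c \<in> clusterings k d X. explainable k d X (fst c)}. ereal (cost d c))"

definition price_of_explainability :: "nat \<Rightarrow> nat \<Rightarrow> ereal" where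
  "price_of_explainability k d =
     (SUP X\<in>{X. kmedians_instance k d X \<and> opt_unr k d X > 0}. opt_exp k d X / opt_unr k d X)"

end

theory Submission
  imports Defs "HOL-Analysis.Lebesgue_Measure"
begin

text \<open>
  Fix a clustering and cut its centres apart. On each coordinate axis, choose in every gap
  between consecutive centres the threshold \<open>\<theta>\<^sub>j\<close> that separates the fewest points from their centres;
  if this number is \<open>w\<^sub>j\<close> and the gap has length \<open>g\<^sub>j\<close>, then averaging over the gap shows that \<open>\<Sum>\<^sub>j w\<^sub>j g\<^sub>j\<close>
  is at most the part of the cost paid along this axis. Arrange the gaps in a binary search tree in which
  cheap gaps are probed first, by bisection among gaps whose \<open>w\<^sub>j\<close> agree up to a factor 2: the
  geometric sum over these classes bounds the total weight of the ancestors of \<open>j\<close> by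
  \<open>O(log k) w\<^sub>j\<close>. Hence, with \<open>H\<^sub>v\<close> the total length of the gaps below \<open>v\<close>,
  \<open>\<Sum>\<^sub>v w\<^sub>v H\<^sub>v = \<Sum>\<^sub>j g\<^sub>j (\<Sum>\<^sub>v w\<^sub>v) \<le> O(log k) \<Sum>\<^sub>j w\<^sub>j g\<^sub>j\<close>, where the inner sum is over the ancestors of \<open>j\<close>.

  A node of the decision tree whose set of centres is widest along axis \<open>i\<close> uses the topmost cut of
  the search tree for \<open>i\<close> that falls within this width. The width is then at most \<open>H\<^sub>v\<close> and the diameter
  of the set at most \<open>d H\<^sub>v\<close>, so a point that is separated here from its centre can be served by any
  other centre of the node at an additional cost of at most \<open>d H\<^sub>v\<close>.
\<close>

section \<open>Search trees on a line of weighted vertices\<close>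

text \<open>\<open>D\<close> is the depth in a balanced search tree on \<open>A\<close>. Two
  elements of equal depth are separated by their lowest common ancestor, which is strictly
  shallower.\<close>

lemma balanced_depth:
  fixes A :: "nat set"
  assumes "finite A" "card A < 2 ^ h"
  shows "\<exists>D. (\<forall>a\<in>A. D a < h) \<and>
    (\<forall>a\<in>A. \<forall>b\<in>A. a < b \<and> D a = D b \<longrightarrow> (\<exists>c\<in>A. a < c \<and> c < b \<and> D c < (D a :: nat)))"
  using assms
proof (induction h arbitrary: A)
  case 0
  then show ?case by auto
next
  case (Suc h)
  show ?case
  proof (cases "A = {}")
    case True
    then show ?thesis by auto
  next
    case False
    \<comment> \<open>The root is the last element with fewer than \<open>2 ^ h\<close>
      predecessors. Its successor then has at least \<open>2 ^ h\<close> of them, which leaves fewer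
      than \<open>2 ^ h\<close> elements to the right of the root.\<close>
    define M where "M = {m \<in> A. card {a \<in> A. a < m} < 2 ^ h}"
    define m where "m = Max M"
    have empty: "{a \<in> A. a < Min A} = {}"
      using Suc.prems(1) by (auto dest: Min_le)
    have "finite M" "M \<noteq> {}"
      using Suc.prems(1) Min_in[OF Suc.prems(1) False] empty
      by (auto simp: M_def simp del: Collect_empty_eq intro!: exI[of _ "Min A"])
    then have "m \<in> M" and m_max: "x \<le> m" if "x \<in> M" for x
      using that by (auto simp: m_def)
    then have m: "m \<in> A" "card {a \<in> A. a < m} < 2 ^ h"
      using \<open>finite M\<close> \<open>M \<noteq> {}\<close> Max_in[of M] by (auto simp: M_def m_def)
    have right: "card {a \<in> A. m < a} < 2 ^ h"
    proof (cases "{a \<in> A. m < a} = {}")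
      case True
      then show ?thesis by (metis card.empty zero_less_numeral zero_less_power)
    next
      case ne: False
      define m' where "m' = Min {a \<in> A. m < a}"
      have m': "m' \<in> A" "m < m'"
        using Min_in[OF _ ne] Suc.prems(1) by (auto simp: m'_def)
      have m'_le: "m' \<le> a" if "a \<in> A" "m < a" for a
        using that Suc.prems(1) by (auto simp: m'_def)
      have "m' \<notin> M" using m_max m' by force
      then have "2 ^ h \<le> card {a \<in> A. a < m'}" using m' by (auto simp: M_def)
      moreover have "A = {a \<in> A. a < m'} \<union> {a \<in> A. m < a}"
        using m'_le m' by (auto intro: order.strict_trans1)
      moreover have "card ({a \<in> A. a < m'} \<union> {a \<in> A. m < a})
          = card {a \<in> A. a < m'} + card {a \<in> A. m < a}"
        by (rule card_Un_disjoint) (use Suc.prems(1) m'_le in \<open>auto simp: not_less[symmetric]\<close>)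
      ultimately show ?thesis using Suc.prems(2) by simp
    qed
    obtain D1 where D1: "\<And>a. a \<in> A \<Longrightarrow> a < m \<Longrightarrow> D1 a < h"
      "\<And>a b. a \<in> A \<Longrightarrow> b \<in> A \<Longrightarrow> a < b \<Longrightarrow> b < m \<Longrightarrow> D1 a = D1 b \<Longrightarrow>
         \<exists>c\<in>A. a < c \<and> c < b \<and> D1 c < D1 a"
      using Suc.IH[OF _ m(2)] Suc.prems(1) by fastforce
    obtain D2 where D2: "\<And>a. a \<in> A \<Longrightarrow> m < a \<Longrightarrow> D2 a < h"
      "\<And>a b. a \<in> A \<Longrightarrow> b \<in> A \<Longrightarrow> a < b \<Longrightarrow> m < a \<Longrightarrow> D2 a = D2 b \<Longrightarrow>
         \<exists>c\<in>A. a < c \<and> c < b \<and> D2 c < D2 a"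
      using Suc.IH[OF _ right] Suc.prems(1) by fastforce
    define D where "D a = (if a = m then 0 else if a < m then Suc (D1 a) else Suc (D2 a))" for a
    have "D a < Suc h" if "a \<in> A" for a
      using that D1(1) D2(1) by (auto simp: D_def)
    moreover have "\<exists>c\<in>A. a < c \<and> c < b \<and> D c < D a"
      if ab: "a \<in> A" "b \<in> A" "a < b" "D a = D b" for a b
    proof -
      consider "b < m" | "m < a" | "a < m" "m < b"
        using ab by (auto simp: D_def split: if_splits)
      then show ?thesis
      proof cases
        case 1
        then obtain c where "c \<in> A" "a < c" "c < b" "D1 c < D1 a"
          using D1(2)[of a b] ab by (auto simp: D_def)
        then show ?thesis using 1 by (intro bexI[of _ c]) (auto simp: D_def)
      next
        case 2
        then obtain c where "c \<in> A" "a < c" "c < b" "D2 c < D2 a"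
          using D2(2)[of a b] ab by (auto simp: D_def)
        then show ?thesis using 2 by (intro bexI[of _ c]) (auto simp: D_def)
      next
        case 3
        then show ?thesis using m by (intro bexI[of _ m]) (auto simp: D_def)
      qed
    qed
    ultimately show ?thesis by blast
  qed
qed

text \<open>The \<open>s\<close> with quotient \<open>c\<close> form a block of length
  \<open>h\<close>, so this is \<open>h\<close> times the geometric sum of \<open>2 ^ c\<close> for
  \<open>c\<close> from 1 to \<open>\<kappa>\<close>. The sum starts at \<open>h\<close> because
  weight class 0 contributes nothing in \<open>priced_search\<close>.\<close>

lemma sum_power_div:
  assumes "0 < h"
  shows "(\<Sum>s = h..<Suc \<kappa> * h. (2::real) ^ (s div h)) = real h * (2 ^ Suc \<kappa> - 2)"
proof (induction \<kappa>)
  case 0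
  then show ?case by simp
next
  case (Suc \<kappa>)
  have "(\<Sum>s = Suc \<kappa> * h..<Suc (Suc \<kappa>) * h. (2::real) ^ (s div h))
      = (\<Sum>s = Suc \<kappa> * h..<Suc (Suc \<kappa>) * h. 2 ^ Suc \<kappa>)"
    by (intro sum.cong refl arg_cong[where f = "(^) 2"] div_nat_eqI) (auto simp: mult.commute)
  then have "(\<Sum>s = Suc \<kappa> * h..<Suc (Suc \<kappa>) * h. (2::real) ^ (s div h)) = real h * 2 ^ Suc \<kappa>"
    by simp
  moreover have "(\<Sum>s = h..<Suc (Suc \<kappa>) * h. (2::real) ^ (s div h)) =
    (\<Sum>s = h..<Suc \<kappa> * h. 2 ^ (s div h)) + (\<Sum>s = Suc \<kappa> * h..<Suc (Suc \<kappa>) * h. 2 ^ (s div h))"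
    by (rule sum.atLeastLessThan_concat[symmetric]) auto
  ultimately show ?case using Suc.IH by (simp add: algebra_simps)
qed

text \<open>The sum runs over \<open>j\<close> and its ancestors in the heap-ordered tree with keys
  \<open>K\<close>. On one side of \<open>j\<close> these have distinct keys, and each weight class
  owns only \<open>h\<close> keys. So class \<open>c\<close> contributes at most
  \<open>h * 2 ^ c\<close>, and the classes up to that of \<open>j\<close> sum geometrically to at
  most \<open>4 * h * w j\<close> per side.\<close>

lemma priced_search:
  fixes w :: "nat \<Rightarrow> nat"
  assumes "n < 2 ^ h" "0 < h"
  obtains K :: "nat \<Rightarrow> nat" where
    "\<And>j. j < n \<Longrightarrow>
       (\<Sum>v | v < n \<and> (\<forall>u. min v j \<le> u \<and> u \<le> max v j \<longrightarrow> K v \<le> K u). real (w v)) \<le> 8 * real h * real (w j)"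
proof -
  \<comment> \<open>Class 0 means weight 0; class \<open>c > 0\<close> means
    \<open>2 ^ (c - 1) \<le> w v < 2 ^ c\<close>.\<close>
  define cl where "cl v = (LEAST c. w v < 2 ^ c)" for v
  have cl_less: "w v < 2 ^ cl v" for v
    unfolding cl_def by (rule LeastI_ex) (metis less_exp)
  have cl_ge: "2 ^ cl v \<le> 2 * w v" if "cl v \<noteq> 0" for v
    using not_less_Least[of "cl v - 1" "\<lambda>c. w v < 2 ^ c"] that
    by (cases "cl v") (auto simp: cl_def[symmetric])
  define level where "level c = {v. v < n \<and> cl v = c}" for c
  have "\<forall>c. \<exists>D. (\<forall>a\<in>level c. D a < h) \<and>
     (\<forall>a\<in>level c. \<forall>b\<in>level c. a < b \<and> D a = D b \<longrightarrow>
        (\<exists>e\<in>level c. a < e \<and> e < b \<and> D e < (D a :: nat)))"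
  proof (intro allI balanced_depth)
    fix c
    have "card (level c) \<le> card {..<n}" by (rule card_mono) (auto simp: level_def)
    then show "card (level c) < 2 ^ h" using assms by simp
  qed (auto simp: level_def)
  from choice[OF this] obtain D :: "nat \<Rightarrow> nat \<Rightarrow> nat" where
    D: "\<forall>c. (\<forall>a\<in>level c. D c a < h) \<and>
     (\<forall>a\<in>level c. \<forall>b\<in>level c. a < b \<and> D c a = D c b \<longrightarrow>
        (\<exists>e\<in>level c. a < e \<and> e < b \<and> D c e < D c a))"
    by (rule exE)
  then have D_less: "D (cl v) v < h" if "v < n" for v
    using that by (auto simp: level_def)
  \<comment> \<open>lexicographic order: first the weight class, then the depth in the bisection of that class\<close>
  define K where "K v = cl v * h + D (cl v) v" for v
  have K_div: "K v div h = cl v" and K_mod: "K v mod h = D (cl v) v" if "v < n" for v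
    using D_less[OF that] by (auto simp: K_def)
  have K_tie: "\<exists>e. a < e \<and> e < b \<and> K e < K a" if "a < b" "b < n" "K a = K b" for a b
  proof -
    have cl: "cl a = cl b" using K_div[of a] K_div[of b] that by simp
    moreover have "D (cl a) a = D (cl b) b" using K_mod[of a] K_mod[of b] that by simp
    moreover have "a \<in> level (cl a)" "b \<in> level (cl a)"
      using that cl by (auto simp: level_def)
    ultimately have "\<exists>e\<in>level (cl a). a < e \<and> e < b \<and> D (cl a) e < D (cl a) a"
      using D that(1) by metis
    then obtain e where "cl e = cl a" "a < e" "e < b" "D (cl a) e < D (cl a) a"
      by (auto simp: level_def)
    then show ?thesis by (auto simp: K_def)
  qed
  have inj_bound: "(\<Sum>v\<in>T. real (w v)) \<le> 4 * real h * real (w j)"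
    if T: "T \<subseteq> {..<n}" "inj_on K T" "\<And>v. v \<in> T \<Longrightarrow> K v \<le> K j" and "j < n" for T j
  proof -
    have fin: "finite T" using T(1) finite_subset by blast
    \<comment> \<open>Class 0 has to contribute exactly nothing, since the bound is 0 when
      \<open>w j = 0\<close>.\<close>
    have w0: "w v = 0" if "v \<in> T" "K v < h" for v
    proof -
      have "cl v = 0" using K_div[of v] that T(1) by auto
      then show ?thesis using cl_less[of v] by simp
    qed
    have K_less: "K j < Suc (cl j) * h" using D_less[OF \<open>j < n\<close>] by (simp add: K_def)
    have "(\<Sum>v\<in>T. real (w v)) = (\<Sum>v | v \<in> T \<and> h \<le> K v. real (w v))"
      using fin w0 by (intro sum.mono_neutral_right) (auto simp: not_le)
    also have "\<dots> \<le> (\<Sum>v | v \<in> T \<and> h \<le> K v. 2 ^ (K v div h))"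
    proof (rule sum_mono)
      fix v assume "v \<in> {v \<in> T. h \<le> K v}"
      then have "K v div h = cl v" using K_div T(1) by auto
      then show "real (w v) \<le> 2 ^ (K v div h)"
        using less_imp_le[OF cl_less[of v]] by (metis of_nat_le_iff of_nat_numeral of_nat_power)
    qed
    \<comment> \<open>The sum passes from vertices to keys; by injectivity every key below
      \<open>Suc (cl j) * h\<close> is counted at most once.\<close>
    also have "\<dots> = (\<Sum>s\<in>K ` {v \<in> T. h \<le> K v}. 2 ^ (s div h))"
      using T(2) by (subst sum.reindex) (auto simp: inj_on_def)
    also have "\<dots> \<le> (\<Sum>s = h..<Suc (cl j) * h. 2 ^ (s div h))"
      using le_less_trans[OF T(3) K_less] by (intro sum_mono2) auto
    also have "\<dots> = real h * (2 ^ Suc (cl j) - 2)" by (rule sum_power_div[OF assms(2)])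
    also have "\<dots> \<le> real h * (4 * real (w j))"
    proof (cases "cl j = 0")
      case False
      then have "real (2 ^ cl j) \<le> real (2 * w j)" using cl_ge of_nat_mono by blast
      then show ?thesis by (intro mult_left_mono) auto
    qed auto
    finally show ?thesis by (simp add: mult_ac)
  qed
  show thesis
  proof
    fix j assume j: "j < n"
    define T where "T = {v. v < n \<and> (\<forall>u. min v j \<le> u \<and> u \<le> max v j \<longrightarrow> K v \<le> K u)}"
    have sub: "T \<subseteq> {..<n}" by (auto simp: T_def)
    have le: "K v \<le> K j" if "v \<in> T" for v using that by (auto simp: T_def)
    \<comment> \<open>A tie \<open>a < b \<le> j\<close> would yield a smaller key between the two,
      but \<open>a\<close> has the least key from \<open>a\<close> to \<open>j\<close>. To the right
      of \<open>j\<close> it is \<open>b\<close> that has the least key from \<open>j\<close> to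
      \<open>b\<close>.\<close>
    have "inj_on K {v \<in> T. v \<le> j}"
    proof (rule linorder_inj_onI)
      fix a b assume ab: "a < b" "a \<in> {v \<in> T. v \<le> j}" "b \<in> {v \<in> T. v \<le> j}"
      show "K a \<noteq> K b"
      proof
        assume eq: "K a = K b"
        then obtain e where "a < e" "e < b" "K e < K a" using K_tie[of a b] ab by (auto simp: T_def)
        moreover from this have "K a \<le> K e" using ab by (auto simp: T_def)
        ultimately show False by simp
      qed
    qed auto
    moreover have "inj_on K {v \<in> T. j < v}"
    proof (rule linorder_inj_onI)
      fix a b assume ab: "a < b" "a \<in> {v \<in> T. j < v}" "b \<in> {v \<in> T. j < v}"
      show "K a \<noteq> K b"
      proof
        assume eq: "K a = K b"
        then obtain e where "a < e" "e < b" "K e < K a" using K_tie[of a b] ab by (auto simp: T_def)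
        moreover from this have "K b \<le> K e" using ab by (auto simp: T_def)
        ultimately show False using eq by simp
      qed
    qed auto
    moreover have "(\<Sum>v\<in>T. real (w v)) = (\<Sum>v | v \<in> T \<and> v \<le> j. real (w v)) + (\<Sum>v | v \<in> T \<and> j < v. real (w v))"
      using sub finite_subset[OF sub]
      by (subst sum.union_disjoint[symmetric]) (auto intro!: sum.cong)
    ultimately show "(\<Sum>v | v < n \<and> (\<forall>u. min v j \<le> u \<and> u \<le> max v j \<longrightarrow> K v \<le> K u). real (w v))
        \<le> 8 * real h * real (w j)"
      using inj_bound[of "{v \<in> T. v \<le> j}" j] inj_bound[of "{v \<in> T. j < v}" j] sub le j
      unfolding T_def[symmetric] by fastforce
  qed
qed

section \<open>Separating thresholds on one axis\<close>

text \<open>Averaging: the number of intervals \<open>[l x, r x)\<close> containing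
  \<open>t\<close>, integrated over \<open>[a, b)\<close>, is their total overlap with
  \<open>[a, b)\<close>, and the least such number does not exceed the mean.\<close>

lemma threshold_exists:
  fixes l r :: "'a \<Rightarrow> real"
  assumes "finite X" "a < b"
  shows "\<exists>\<theta>. a \<le> \<theta> \<and> \<theta> < b \<and>
    real (card {x \<in> X. l x \<le> \<theta> \<and> \<theta> < r x}) * (b - a) \<le> (\<Sum>x\<in>X. max 0 (min (r x) b - max (l x) a))"
proof -
  define N where "N \<theta> = card {x \<in> X. l x \<le> \<theta> \<and> \<theta> < r x}" for \<theta>
  \<comment> \<open>The minimum is attained because the counts are natural numbers.\<close>
  obtain \<theta> where \<theta>: "\<theta> \<in> {a..<b}" "\<And>t. t \<in> {a..<b} \<Longrightarrow> N \<theta> \<le> N t"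
    using assms(2) exists_least_iff[of "\<lambda>m. \<exists>t\<in>{a..<b}. N t = m"]
    by (metis atLeastLessThan_iff linorder_not_less order_refl)
  have int: "integrable lborel (indicator {max (l x) a..<min (r x) b} :: real \<Rightarrow> real)" for x
    by (cases "max (l x) a \<le> min (r x) b") (simp_all add: emeasure_lborel_Ico del: max.bounded_iff min.bounded_iff)
  have "real (N \<theta>) * (b - a) = (\<integral>t. real (N \<theta>) * indicator {a..<b} t \<partial>lborel)"
    using assms(2) by simp
  also have "\<dots> \<le> (\<integral>t. (\<Sum>x\<in>X. indicator {max (l x) a..<min (r x) b} t) \<partial>lborel)"
  proof (rule integral_mono)
    show "integrable lborel (\<lambda>t. real (N \<theta>) * indicator {a..<b} t)"
      using assms(2) by (intro integrable_mult_right) simp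
    show "integrable lborel (\<lambda>t. \<Sum>x\<in>X. indicator {max (l x) a..<min (r x) b} t :: real)"
      by (intro integrable_sum int)
    fix t
    have "(\<Sum>x\<in>X. indicator {max (l x) a..<min (r x) b} t :: real) = real (N t)" if "t \<in> {a..<b}"
    proof -
      have "(\<Sum>x\<in>X. indicator {max (l x) a..<min (r x) b} t :: real)
          = (\<Sum>x\<in>X. if l x \<le> t \<and> t < r x then 1 else 0)"
        using that by (intro sum.cong) (auto simp: indicator_def)
      then show ?thesis using assms(1) by (simp add: sum.If_cases N_def Int_def)
    qed
    then show "real (N \<theta>) * indicator {a..<b} t \<le> (\<Sum>x\<in>X. indicator {max (l x) a..<min (r x) b} t)"
      using \<theta>(2)[of t] by (cases "t \<in> {a..<b}") (auto intro: sum_nonneg)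
  qed
  also have "\<dots> = (\<Sum>x\<in>X. \<integral>t. indicator {max (l x) a..<min (r x) b} t \<partial>lborel)"
    by (intro Bochner_Integration.integral_sum int)
  also have "\<dots> = (\<Sum>x\<in>X. max 0 (min (r x) b - max (l x) a))"
  proof (rule sum.cong[OF refl])
    fix x
    show "(\<integral>t. indicator {max (l x) a..<min (r x) b} t \<partial>lborel) = max 0 (min (r x) b - max (l x) a)"
      by (cases "max (l x) a \<le> min (r x) b")
        (simp_all add: measure_def emeasure_lborel_Ico del: max.bounded_iff min.bounded_iff)
  qed
  finally show ?thesis using \<theta>(1) by (intro exI[of _ \<theta>]) (auto simp: N_def)
qed

lemma sum_overlap_le:
  fixes u :: "nat \<Rightarrow> real"
  assumes "\<And>j. j < n \<Longrightarrow> u j \<le> u (Suc j)" "l \<le> r"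
  shows "(\<Sum>j<n. max 0 (min r (u (Suc j)) - max l (u j))) \<le> r - l"
proof -
  \<comment> \<open>The induction needs the sharper bound by the overlap of \<open>[l, r)\<close>
    with \<open>[u 0, u n)\<close>, which leaves room for the next cell.\<close>
  have "u 0 \<le> u n \<and> (\<Sum>j<n. max 0 (min r (u (Suc j)) - max l (u j))) \<le> max 0 (min r (u n) - max l (u 0))"
    using assms(1)
  proof (induction n)
    case 0
    then show ?case by simp
  next
    case (Suc n)
    have IH: "u 0 \<le> u n"
      "(\<Sum>j<n. max 0 (min r (u (Suc j)) - max l (u j))) \<le> max 0 (min r (u n) - max l (u 0))"
      using Suc.IH Suc.prems by auto
    moreover have "max 0 (min r (u n) - max l (u 0)) + max 0 (min r (u (Suc n)) - max l (u n))
        \<le> max 0 (min r (u (Suc n)) - max l (u 0))"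
      using IH(1) Suc.prems[of n] assms(2) by (auto simp: max_def min_def)
    ultimately show ?case using Suc.prems[of n] by auto
  qed
  then show ?thesis using assms(2) by (auto simp: max_def min_def split: if_splits)
qed

text \<open>\<open>V\<close> will hold the coordinates of the centres, \<open>p x\<close> and
  \<open>q x\<close> those of a point and its centre. \<open>H \<theta>\<close> is the total length
  of the gaps in the subtree rooted at the gap of \<open>\<theta>\<close>; it bounds every width for
  which \<open>\<theta>\<close> is the topmost cut.\<close>

lemma line_thresholds:
  fixes p q :: "'a \<Rightarrow> real"
  assumes "finite X" "finite V" "V \<noteq> {}" "card V \<le> 2 ^ h" "0 < h"
  obtains \<Theta> :: "real set" and H :: "real \<Rightarrow> real" where
    "finite \<Theta>" "\<And>\<theta>. 0 \<le> H \<theta>"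
    "\<And>a b. a \<in> V \<Longrightarrow> b \<in> V \<Longrightarrow> a < b \<Longrightarrow> \<exists>\<theta>\<in>\<Theta>. a \<le> \<theta> \<and> \<theta> < b \<and> b - a \<le> H \<theta>"
    "(\<Sum>\<theta>\<in>\<Theta>. real (card {x \<in> X. (p x \<le> \<theta>) \<noteq> (q x \<le> \<theta>)}) * H \<theta>) \<le> 8 * real h * (\<Sum>x\<in>X. \<bar>p x - q x\<bar>)"
proof -
  define u where "u j = sorted_list_of_set V ! j" for j
  \<comment> \<open>The \<open>n + 1\<close> elements of \<open>V\<close> bound \<open>n\<close>
    gaps, and \<open>n < 2 ^ h\<close> is what \<open>priced_search\<close> asks for.\<close>
  define n where "n = card V - 1"
  have cardV: "card V = Suc n" using assms(2,3) by (simp add: n_def card_gt_0_iff)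
  have u_less: "u i < u j" if "i < j" "j \<le> n" for i j
    using that strict_sorted_list_of_set[of V] cardV
    by (auto simp: u_def sorted_wrt_iff_nth_less)
  have u_le_iff: "u i \<le> u j \<longleftrightarrow> i \<le> j" and u_less_iff: "u i < u j \<longleftrightarrow> i < j" if "i \<le> n" "j \<le> n" for i j
    using u_less[of i j] u_less[of j i] that by (cases i j rule: linorder_cases; force)+
  have V: "V = u ` {..n}"
    using assms(2) cardV set_conv_nth[of "sorted_list_of_set V"]
    by (auto simp: u_def image_iff less_Suc_eq_le)
  define w where "w \<theta> = card {x \<in> X. (p x \<le> \<theta>) \<noteq> (q x \<le> \<theta>)}" for \<theta>
  define gap where "gap j = u (Suc j) - u j" for j
  define ov where "ov x j = max 0 (min (max (p x) (q x)) (u (Suc j)) - max (min (p x) (q x)) (u j))" for x j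
  have sep: "((p x \<le> \<theta>) \<noteq> (q x \<le> \<theta>)) \<longleftrightarrow> min (p x) (q x) \<le> \<theta> \<and> \<theta> < max (p x) (q x)" for x \<theta>
    by auto
  have "\<exists>\<theta>. j < n \<longrightarrow> u j \<le> \<theta> \<and> \<theta> < u (Suc j) \<and> real (w \<theta>) * gap j \<le> (\<Sum>x\<in>X. ov x j)" for j
    using threshold_exists[OF assms(1), of "u j" "u (Suc j)" "\<lambda>x. min (p x) (q x)" "\<lambda>x. max (p x) (q x)"]
      u_less[of j "Suc j"] unfolding w_def gap_def ov_def sep by force
  then obtain t where t: "\<And>j. j < n \<Longrightarrow> u j \<le> t j" "\<And>j. j < n \<Longrightarrow> t j < u (Suc j)"
    "\<And>j. j < n \<Longrightarrow> real (w (t j)) * gap j \<le> (\<Sum>x\<in>X. ov x j)"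
    by metis
  have t_less: "t i < t j" if "i < j" "j < n" for i j
  proof -
    have "t i < u (Suc i)" using t(2) that by simp
    also have "\<dots> \<le> u j" using u_le_iff that by simp
    also have "\<dots> \<le> t j" using t(1) that by simp
    finally show ?thesis .
  qed
  have t_inj: "inj_on t {..<n}"
    by (rule linorder_inj_onI) (use t_less in force)+
  obtain K :: "nat \<Rightarrow> nat" where K: "\<And>j. j < n \<Longrightarrow>
      (\<Sum>v | v < n \<and> (\<forall>e. min v j \<le> e \<and> e \<le> max v j \<longrightarrow> K v \<le> K e). real (w (t v)))
        \<le> 8 * real h * real (w (t j))"
    using priced_search[of n h "\<lambda>v. w (t v)"] cardV assms(4,5) by auto
  \<comment> \<open>The search tree is the heap-ordered tree with priorities \<open>K\<close>: the root of an interval minimises \<open>K\<close>.\<close>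
  define anc where "anc v j \<longleftrightarrow> (\<forall>e. min v j \<le> e \<and> e \<le> max v j \<longrightarrow> K v \<le> K e)" for v j
  define G where "G v = (\<Sum>j | j < n \<and> anc v j. gap j)" for v
  have gap_nonneg: "0 \<le> gap j" if "j < n" for j
    using u_less[of j "Suc j"] that by (simp add: gap_def)
  \<comment> \<open>Lengths are attached to thresholds rather than gap indices, hence the inverse of
    \<open>t\<close>; the value 0 elsewhere keeps \<open>H\<close> nonnegative.\<close>
  define H where "H \<theta> = (if \<theta> \<in> t ` {..<n} then G (the_inv_into {..<n} t \<theta>) else 0)" for \<theta>
  have H_t: "H (t v) = G v" if "v < n" for v
    using the_inv_into_f_f[OF t_inj, of v] that by (simp add: H_def)
  show thesis
  proof
    show "finite (t ` {..<n})" by simp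
    show "0 \<le> H \<theta>" for \<theta>
      unfolding H_def G_def using gap_nonneg by (auto intro: sum_nonneg)
  next
    fix a b assume "a \<in> V" "b \<in> V" "a < b"
    then obtain i j where ij: "i \<le> n" "j \<le> n" "a = u i" "b = u j" by (auto simp: V)
    then have "i < j" using u_less_iff \<open>a < b\<close> by simp
    \<comment> \<open>The gap of least key between \<open>a\<close> and \<open>b\<close> is an
      ancestor of all gaps there, so \<open>G v\<close> covers the full distance.\<close>
    obtain v where v: "v \<in> {i..<j}" "\<And>e. e \<in> {i..<j} \<Longrightarrow> K v \<le> K e"
      using ex_min_if_finite[of "K ` {i..<j}"] \<open>i < j\<close> by (fastforce simp: not_less)
    have "v < n" using v(1) ij by simp
    have "b - a = (\<Sum>j' = i..<j. gap j')"
      using sum_Suc_diff'[of i j u] \<open>i < j\<close> ij by (simp add: gap_def)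
    also have "\<dots> \<le> G v"
      unfolding G_def
    proof (rule sum_mono2)
      show "{i..<j} \<subseteq> {j. j < n \<and> anc v j}"
        using v ij by (auto simp: anc_def min_def max_def split: if_splits)
    qed (auto intro: gap_nonneg)
    finally have "b - a \<le> H (t v)" by (simp add: H_t \<open>v < n\<close>)
    moreover have "a \<le> t v"
      using u_le_iff[of i v] t(1)[of v] v(1) ij \<open>v < n\<close> by simp
    moreover have "t v < b"
      using u_le_iff[of "Suc v" j] t(2)[of v] v(1) ij \<open>v < n\<close> by simp
    ultimately show "\<exists>\<theta>\<in>t ` {..<n}. a \<le> \<theta> \<and> \<theta> < b \<and> b - a \<le> H \<theta>"
      using \<open>v < n\<close> by auto
  next
    have "(\<Sum>\<theta>\<in>t ` {..<n}. real (w \<theta>) * H \<theta>) = (\<Sum>v<n. real (w (t v)) * G v)"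
      using t_inj by (simp add: sum.reindex H_t)
    also have "\<dots> = (\<Sum>v<n. \<Sum>j | j \<in> {..<n} \<and> anc v j. real (w (t v)) * gap j)"
      by (simp add: G_def sum_distrib_left)
    \<comment> \<open>After the exchange, gap \<open>j\<close> is multiplied by the total weight of
      its ancestors, which \<open>priced_search\<close> bounds by the weight of
      \<open>j\<close>.\<close>
    also have "\<dots> = (\<Sum>j<n. \<Sum>v | v \<in> {..<n} \<and> anc v j. real (w (t v)) * gap j)"
      by (rule sum.swap_restrict) auto
    also have "\<dots> = (\<Sum>j<n. (\<Sum>v | v < n \<and> anc v j. real (w (t v))) * gap j)"
      by (simp add: sum_distrib_right)
    also have "\<dots> \<le> (\<Sum>j<n. 8 * real h * (\<Sum>x\<in>X. ov x j))"
    proof (rule sum_mono)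
      fix j assume j: "j \<in> {..<n}"
      have "(\<Sum>v | v < n \<and> anc v j. real (w (t v))) * gap j \<le> (8 * real h * real (w (t j))) * gap j"
        using K[of j] j gap_nonneg by (intro mult_right_mono) (auto simp: anc_def)
      also have "\<dots> = 8 * real h * (real (w (t j)) * gap j)" by simp
      also have "\<dots> \<le> 8 * real h * (\<Sum>x\<in>X. ov x j)"
        using t(3)[of j] j by (intro mult_left_mono) auto
      finally show "(\<Sum>v | v < n \<and> anc v j. real (w (t v))) * gap j \<le> 8 * real h * (\<Sum>x\<in>X. ov x j)" .
    qed
    also have "\<dots> = 8 * real h * (\<Sum>x\<in>X. \<Sum>j<n. ov x j)"
      by (subst sum.swap) (simp add: sum_distrib_left)
    also have "\<dots> \<le> 8 * real h * (\<Sum>x\<in>X. \<bar>p x - q x\<bar>)"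
    proof (intro mult_left_mono sum_mono)
      fix x
      have "(\<Sum>j<n. ov x j) \<le> max (p x) (q x) - min (p x) (q x)"
        unfolding ov_def by (rule sum_overlap_le) (use u_less in \<open>auto intro: less_imp_le\<close>)
      then show "(\<Sum>j<n. ov x j) \<le> \<bar>p x - q x\<bar>" by linarith
    qed auto
    finally show "(\<Sum>\<theta>\<in>t ` {..<n}. real (card {x \<in> X. (p x \<le> \<theta>) \<noteq> (q x \<le> \<theta>)}) * H \<theta>)
        \<le> 8 * real h * (\<Sum>x\<in>X. \<bar>p x - q x\<bar>)"
      by (simp add: w_def)
  qed
qed

section \<open>Decision trees built from cuts between centres\<close>

text \<open>\<open>S\<close> consists of the centres that reach a node, \<open>c x\<close> is the
  original centre of \<open>x\<close>, and \<open>b x\<close> the allowed extra distance. Only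
  points whose centre is still in \<open>S\<close> have to be served; the others are charged at the
  cut that separates them from it.\<close>

definition cut_tree :: "nat \<Rightarrow> nat \<Rightarrow> point set \<Rightarrow> point set \<Rightarrow> (point \<Rightarrow> point) \<Rightarrow> (point \<Rightarrow> real) \<Rightarrow> decision_tree \<Rightarrow> bool"
  where "cut_tree n d X S c b t \<longleftrightarrow> cuts_in_dim d t \<and> size1 t = n \<and>
    partition_on X (leaf_cells t X) \<and> card (leaf_cells t X) = n \<and>
    (\<forall>A\<in>leaf_cells t X. \<exists>m\<in>S. \<forall>x\<in>A. c x \<in> S \<longrightarrow> l1_dist d (c x) m \<le> b x)"

lemma cut_tree_Leaf:
  assumes "X \<noteq> {}" "m \<in> S" "\<And>x. x \<in> X \<Longrightarrow> c x \<in> S \<Longrightarrow> l1_dist d (c x) m \<le> b x"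
  shows "cut_tree 1 d X S c b Leaf"
  using assms by (auto simp: cut_tree_def cuts_in_dim_def intro!: partition_on_space)

text \<open>A point whose centre stays on its side is served by the subtree; any other point with
  centre in \<open>S\<close> is separated here, and \<open>bl\<close> or \<open>br\<close> pays for
  an arbitrary centre of its side. \<open>S1\<close> and \<open>S2\<close> may overlap, so that a
  cell can also be split with the same centres on both sides.\<close>

lemma cut_tree_Node:
  assumes "i < d" "finite X"
    and l: "cut_tree n1 d {x \<in> X. x i \<le> \<theta>} S1 c b l"
    and r: "cut_tree n2 d {x \<in> X. x i > \<theta>} S2 c b r"
    and "S1 \<subseteq> S" "S2 \<subseteq> S"
    and bl: "\<And>x m. x \<in> X \<Longrightarrow> x i \<le> \<theta> \<Longrightarrow> c x \<in> S - S1 \<Longrightarrow> m \<in> S1 \<Longrightarrow> l1_dist d (c x) m \<le> b x"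
    and br: "\<And>x m. x \<in> X \<Longrightarrow> x i > \<theta> \<Longrightarrow> c x \<in> S - S2 \<Longrightarrow> m \<in> S2 \<Longrightarrow> l1_dist d (c x) m \<le> b x"
  shows "cut_tree (n1 + n2) d X S c b (Node l (i, \<theta>) r)"
proof -
  let ?X1 = "{x \<in> X. x i \<le> \<theta>}" and ?X2 = "{x \<in> X. x i > \<theta>}"
  let ?L = "leaf_cells l ?X1" and ?R = "leaf_cells r ?X2"
  have p1: "partition_on ?X1 ?L" and p2: "partition_on ?X2 ?R"
    using l r by (auto simp: cut_tree_def)
  have disj: "disjnt ?X1 ?X2" by (auto simp: disjnt_def)
  have X: "?X1 \<union> ?X2 = X" by auto
  have sub1: "A \<subseteq> ?X1" "A \<noteq> {}" if "A \<in> ?L" for A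
    using that p1 by (auto simp: partition_on_def)
  have sub2: "A \<subseteq> ?X2" if "A \<in> ?R" for A
    using that p2 by (auto simp: partition_on_def)
  have "\<Union>?L = ?X1" "\<Union>?R = ?X2"
    using p1 p2 by (simp_all add: partition_on_def)
  then have part: "partition_on X (?L \<union> ?R)"
    using p1 p2 X disj disjoint_union[of ?L ?R] by (simp add: partition_on_def disjnt_def)
  have "?L \<inter> ?R = {}" using sub1 sub2 by fastforce
  moreover have "finite ?L" "finite ?R"
    using finite_elements[OF _ p1] finite_elements[OF _ p2] assms(2) by auto
  ultimately have card: "card (?L \<union> ?R) = n1 + n2"
    using l r by (simp add: card_Un_disjoint cut_tree_def)
  have "\<exists>m\<in>S. \<forall>x\<in>A. c x \<in> S \<longrightarrow> l1_dist d (c x) m \<le> b x" if A: "A \<in> ?L \<union> ?R" for A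
    using A
  proof
    assume "A \<in> ?L"
    then obtain m where m: "m \<in> S1" "\<forall>x\<in>A. c x \<in> S1 \<longrightarrow> l1_dist d (c x) m \<le> b x"
      using l by (auto simp: cut_tree_def)
    show ?thesis
    proof (intro bexI ballI impI)
      show "m \<in> S" using m assms(5) by auto
      fix x assume "x \<in> A" "c x \<in> S"
      then show "l1_dist d (c x) m \<le> b x"
        using m bl[of x m] sub1[OF \<open>A \<in> ?L\<close>] by (cases "c x \<in> S1") auto
    qed
  next
    assume "A \<in> ?R"
    then obtain m where m: "m \<in> S2" "\<forall>x\<in>A. c x \<in> S2 \<longrightarrow> l1_dist d (c x) m \<le> b x"
      using r by (auto simp: cut_tree_def)
    show ?thesis
    proof (intro bexI ballI impI)
      show "m \<in> S" using m assms(6) by auto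
      fix x assume "x \<in> A" "c x \<in> S"
      then show "l1_dist d (c x) m \<le> b x"
        using m br[of x m] sub2[OF \<open>A \<in> ?R\<close>] by (cases "c x \<in> S2") auto
    qed
  qed
  then show ?thesis
    using part card l r assms(1) by (auto simp: cut_tree_def cuts_in_dim_def)
qed

lemma card_threshold_split:
  fixes \<theta> :: real
  assumes "finite X"
  shows "card X = card {x \<in> X. f x \<le> \<theta>} + card {x \<in> X. f x > \<theta>}"
proof -
  have "card X = card ({x \<in> X. f x \<le> \<theta>} \<union> {x \<in> X. f x > \<theta>})" by (rule arg_cong[of _ _ card]) auto
  also have "\<dots> = card {x \<in> X. f x \<le> \<theta>} + card {x \<in> X. f x > \<theta>}"
    using assms by (intro card_Un_disjoint) auto
  finally show ?thesis .
qed

lemma l1_dist_self [simp]: "l1_dist d x x = 0"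
  by (simp add: l1_dist_def)

text \<open>Centres may lose all their points and cells may have to be split further to
  reach exactly \<open>n\<close> nonempty leaves; this is why \<open>n\<close> ranges over a whole interval.\<close>

lemma cut_tree_exists:
  assumes "finite X" "X \<subseteq> euclid d" "X \<noteq> {}" "finite S" "S \<noteq> {}"
    and "min (card S) (card X) \<le> n" "n \<le> card X"
    and "\<And>x. x \<in> X \<Longrightarrow> 0 \<le> b x"
    and "\<And>S'. S' \<subseteq> S \<Longrightarrow> 2 \<le> card S' \<Longrightarrow> \<exists>i<d. \<exists>\<theta>. (\<exists>m\<in>S'. m i \<le> \<theta>) \<and> (\<exists>m\<in>S'. m i > \<theta>) \<and>
        (\<forall>x\<in>X. c x \<in> S' \<and> (x i \<le> \<theta>) \<noteq> (c x i \<le> \<theta>) \<longrightarrow> (\<forall>m\<in>S'. l1_dist d (c x) m \<le> b x))"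
  shows "\<exists>t. cut_tree n d X S c b t"
  using assms
\<comment> \<open>The sum decreases even when only one of the two sets shrinks: only
  \<open>X\<close> if a single centre is left, only \<open>S\<close> if all points lie on one
  side.\<close>
proof (induction "card X + card S" arbitrary: X S n rule: less_induct)
  case less
  note prems = less.prems
  have cX: "0 < card X" and cS: "0 < card S" using prems by (simp_all add: card_gt_0_iff)
  have IH: "\<exists>t. cut_tree n' d X' S' c b t"
    if "X' \<subseteq> X" "X' \<noteq> {}" "S' \<subseteq> S" "S' \<noteq> {}" "card X' + card S' < card X + card S"
      "min (card S') (card X') \<le> n'" "n' \<le> card X'" for n' X' S'
  proof (rule less.hyps)
    show "finite X'" "finite S'" using that prems(1,4) finite_subset by blast+
    show "X' \<subseteq> euclid d" using that prems(2) by blast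
    show "0 \<le> b x" if "x \<in> X'" for x using prems(8) that \<open>X' \<subseteq> X\<close> by blast
    show "\<exists>i<d. \<exists>\<theta>. (\<exists>m\<in>S''. m i \<le> \<theta>) \<and> (\<exists>m\<in>S''. m i > \<theta>) \<and>
      (\<forall>x\<in>X'. c x \<in> S'' \<and> (x i \<le> \<theta>) \<noteq> (c x i \<le> \<theta>) \<longrightarrow> (\<forall>m\<in>S''. l1_dist d (c x) m \<le> b x))"
      if "S'' \<subseteq> S'" "2 \<le> card S''" for S''
    proof -
      have "S'' \<subseteq> S" using that \<open>S' \<subseteq> S\<close> by blast
      from prems(9)[OF this that(2)] obtain i \<theta> where "i < d" "\<exists>m\<in>S''. m i \<le> \<theta>" "\<exists>m\<in>S''. m i > \<theta>"
        "\<forall>x\<in>X. c x \<in> S'' \<and> (x i \<le> \<theta>) \<noteq> (c x i \<le> \<theta>) \<longrightarrow> (\<forall>m\<in>S''. l1_dist d (c x) m \<le> b x)"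
        by blast
      then show ?thesis
        using \<open>X' \<subseteq> X\<close> by (intro exI[of _ i] conjI exI[of _ \<theta>]) blast+
    qed
  qed (use that in auto)
  show ?case
  proof (cases "card S = 1")
    case True
    then obtain s where s: "S = {s}" by (auto simp: card_1_singleton_iff)
    show ?thesis
    proof (cases "n = 1")
      case True
      have "cut_tree 1 d X S c b Leaf"
        using prems(3,8) s by (intro cut_tree_Leaf[of _ s]) auto
      then show ?thesis using True by blast
    next
      case False
      \<comment> \<open>A point with the only centre has distance 0 to it, so every cut is
        admissible; one on an axis where two points differ makes both sides nonempty.\<close>
      then have n: "2 \<le> n" using prems(6) cX cS by linarith
      then have "\<not> card X \<le> Suc 0" using prems(7) by simp
      then obtain x y where xy: "x \<in> X" "y \<in> X" "x \<noteq> y"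
        using card_le_Suc0_iff_eq[OF prems(1)] by blast
      then have "\<exists>i<d. x i \<noteq> y i"
        using prems(2) PiE_ext[of x "{..<d}" "\<lambda>_. UNIV" y] unfolding euclid_def by blast
      then obtain i where "i < d" "x i \<noteq> y i" by blast
      then obtain z z' where i: "i < d" "z \<in> X" "z' \<in> X" "z i < z' i"
        using xy by (metis linorder_neqE_linordered_idom)
      define \<theta> where "\<theta> = z i"
      let ?X1 = "{x \<in> X. x i \<le> \<theta>}" and ?X2 = "{x \<in> X. x i > \<theta>}"
      have ne: "?X1 \<noteq> {}" "?X2 \<noteq> {}" using i by (auto simp: \<theta>_def)
      then have pos: "0 < card ?X1" "0 < card ?X2" using prems(1) by (simp_all add: card_gt_0_iff)
      have sum: "card X = card ?X1 + card ?X2" using prems(1) by (rule card_threshold_split)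
      \<comment> \<open>The left side gets as many leaves as it can hold while one remains for the
        right.\<close>
      define n1 where "n1 = min (card ?X1) (n - 1)"
      have n1: "1 \<le> n1" "n1 \<le> card ?X1" "1 \<le> n - n1" "n - n1 \<le> card ?X2" "n1 + (n - n1) = n"
        using n pos sum prems(7) by (auto simp: n1_def)
      have "\<exists>t. cut_tree n1 d ?X1 S c b t" "\<exists>t. cut_tree (n - n1) d ?X2 S c b t"
        by (rule IH; use n1 ne sum pos prems(5) True in auto)+
      then show ?thesis
        using cut_tree_Node[OF i(1) prems(1), of n1 \<theta> S c b _ "n - n1" S _ S] n1(5) by auto
    qed
  next
    case False
    then have "2 \<le> card S" using cS by linarith
    then obtain i \<theta> where i: "i < d" "\<exists>m\<in>S. m i \<le> \<theta>" "\<exists>m\<in>S. m i > \<theta>"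
      and bb: "\<And>x m. x \<in> X \<Longrightarrow> c x \<in> S \<Longrightarrow> (x i \<le> \<theta>) \<noteq> (c x i \<le> \<theta>) \<Longrightarrow> m \<in> S \<Longrightarrow> l1_dist d (c x) m \<le> b x"
      using prems(9)[of S] by blast
    let ?X1 = "{x \<in> X. x i \<le> \<theta>}" and ?X2 = "{x \<in> X. x i > \<theta>}"
    let ?S1 = "{x \<in> S. x i \<le> \<theta>}" and ?S2 = "{x \<in> S. x i > \<theta>}"
    have neS: "?S1 \<noteq> {}" "?S2 \<noteq> {}" using i by auto
    then have posS: "0 < card ?S1" "0 < card ?S2" using prems(4) by (simp_all add: card_gt_0_iff)
    have sumX: "card X = card ?X1 + card ?X2" using prems(1) by (rule card_threshold_split)
    have sumS: "card S = card ?S1 + card ?S2" using prems(4) by (rule card_threshold_split)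
    \<comment> \<open>If one side has no points, no node is made and the centres of that side are
      dropped. The points that belonged to them are separated by the cut, so \<open>bb\<close> pays
      for any centre.\<close>
    have widen: "cut_tree n d X S c b t"
      if t: "cut_tree n d X S' c b t" and S': "S' \<subseteq> S"
        and far: "\<And>x. x \<in> X \<Longrightarrow> c x \<in> S - S' \<Longrightarrow> (x i \<le> \<theta>) \<noteq> (c x i \<le> \<theta>)" for S' t
    proof -
      have "\<exists>m\<in>S. \<forall>x\<in>A. c x \<in> S \<longrightarrow> l1_dist d (c x) m \<le> b x" if A: "A \<in> leaf_cells t X" for A
      proof -
        have "A \<subseteq> X" using A t by (auto simp: cut_tree_def partition_on_def)
        obtain m where m: "m \<in> S'" "\<forall>x\<in>A. c x \<in> S' \<longrightarrow> l1_dist d (c x) m \<le> b x"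
          using A t by (auto simp: cut_tree_def)
        have "l1_dist d (c x) m \<le> b x" if "x \<in> A" "c x \<in> S" for x
          using that m bb[of x m] far[of x] \<open>A \<subseteq> X\<close> S' by (cases "c x \<in> S'") auto
        then show ?thesis using m S' by blast
      qed
      then show ?thesis using t by (auto simp: cut_tree_def)
    qed
    consider "?X1 = {}" | "?X2 = {}" | "?X1 \<noteq> {}" "?X2 \<noteq> {}" by blast
    then show ?thesis
    proof cases
      case 1
      then have "\<exists>t. cut_tree n d X ?S2 c b t"
        by (intro IH) (use prems neS posS sumS in auto)
      moreover have "(x i \<le> \<theta>) \<noteq> (c x i \<le> \<theta>)" if "x \<in> X" "c x \<in> S - ?S2" for x
        using that 1 by auto
      ultimately show ?thesis using widen[of ?S2] by blast
    next
      case 2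
      then have "\<exists>t. cut_tree n d X ?S1 c b t"
        by (intro IH) (use prems neS posS sumS in auto)
      moreover have "(x i \<le> \<theta>) \<noteq> (c x i \<le> \<theta>)" if "x \<in> X" "c x \<in> S - ?S1" for x
        using that 2 by auto
      ultimately show ?thesis using widen[of ?S1] by blast
    next
      case 3
      then have posX: "0 < card ?X1" "0 < card ?X2" using prems(1) by (simp_all add: card_gt_0_iff)
      \<comment> \<open>The right side is reserved its least number of leaves and takes more only if
        the left side is full. The two least numbers add up to at most
        \<open>min (card S) (card X)\<close>.\<close>
      define n1 where "n1 = min (card ?X1) (n - min (card ?S2) (card ?X2))"
      have n1: "min (card ?S1) (card ?X1) \<le> n1" "n1 \<le> card ?X1"
        "min (card ?S2) (card ?X2) \<le> n - n1" "n - n1 \<le> card ?X2" "n1 + (n - n1) = n"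
        using prems(6,7) sumX sumS by (auto simp: n1_def)
      have "\<exists>t. cut_tree n1 d ?X1 ?S1 c b t" "\<exists>t. cut_tree (n - n1) d ?X2 ?S2 c b t"
        by (rule IH; use n1 3 neS posS sumS sumX in auto)+
      then obtain l r where "cut_tree n1 d ?X1 ?S1 c b l" "cut_tree (n - n1) d ?X2 ?S2 c b r"
        by blast
      then have "cut_tree (n1 + (n - n1)) d X S c b (Node l (i, \<theta>) r)"
        by (rule cut_tree_Node[OF i(1) prems(1)]) (auto intro: bb)
      then show ?thesis using n1(5) by auto
    qed
  qed
qed

section \<open>Comparison of costs\<close>

lemma sum_partition_on:
  assumes "finite X" "partition_on X P"
  shows "(\<Sum>A\<in>P. \<Sum>x\<in>A. f x) = (\<Sum>x\<in>X. f x)"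
proof -
  have "\<forall>A\<in>P. finite A"
    using assms by (auto simp: partition_on_def intro: finite_subset)
  moreover have "\<forall>A\<in>P. \<forall>B\<in>P. A \<noteq> B \<longrightarrow> A \<inter> B = {}"
    using assms(2) by (auto simp: partition_on_def disjoint_def)
  ultimately have "sum f (\<Union>P) = (\<Sum>A\<in>P. \<Sum>x\<in>A. f x)"
    by (simp add: sum.Union_disjoint)
  then show ?thesis using assms(2) by (simp add: partition_on_def)
qed

lemma l1_dist_triangle: "l1_dist d x z \<le> l1_dist d x y + l1_dist d y z"
  unfolding l1_dist_def sum.distrib[symmetric] by (intro sum_mono) linarith

text \<open>Rounding up \<open>log 2 k\<close> at most doubles it, as it is at least 1;
  \<open>ln 2 \<ge> 1 / 2\<close> gives the other factor 2.\<close>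

lemma log2_bound:
  assumes "2 \<le> k"
  obtains h where "k \<le> 2 ^ h" "0 < h" "real h \<le> 4 * ln (real k)"
proof
  define h where "h = nat \<lceil>log 2 (real k)\<rceil>"
  have log: "1 \<le> log 2 (real k)" using assms by simp
  have "real k = 2 powr (log 2 (real k))" using assms by simp
  also have "\<dots> \<le> 2 powr real h" unfolding h_def by (intro powr_mono) linarith+
  finally show "k \<le> 2 ^ h"
    by (metis numeral_power_le_of_nat_cancel_iff of_nat_le_iff of_nat_numeral of_nat_power powr_realpow zero_less_numeral)
  show "0 < h" using log by (simp add: h_def)
  have "real h \<le> log 2 (real k) + 1" unfolding h_def using log by linarith
  also have "\<dots> \<le> 2 * log 2 (real k)" using log by simp
  also have "\<dots> \<le> 4 * ln (real k)"
  proof -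
    have "1 / 2 \<le> ln (2::real)" using ln_ge_iff[of 2 "1 / 2"] exp_half_le2 by linarith
    moreover have "0 \<le> ln (real k)" using assms by simp
    ultimately show ?thesis
      using mult_left_mono[of "1 / 2" "ln 2" "ln (real k)"]
      by (simp add: log_def field_simps)
  qed
  finally show "real h \<le> 4 * ln (real k)" .
qed

text \<open>Comparing with every clustering, not just an optimal one, allows passing to the infimum
  without knowing that it is attained.\<close>

lemma explainable_clustering_exists:
  assumes inst: "kmedians_instance k d X" and "2 \<le> k" "1 \<le> d"
    and clust: "(P, \<mu>) \<in> clusterings k d X"
  shows "\<exists>C\<in>clusterings k d X. explainable k d X (fst C) \<and>
    cost d C \<le> 36 * real d * ln (real k) * cost d (P, \<mu>)"
proof -
  have X: "finite X" "X \<subseteq> euclid d" "k \<le> card X" "X \<noteq> {}"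
    using inst assms(2) by (auto simp: kmedians_instance_def)
  have P: "partition_on X P" "card P = k" "\<mu> ` P \<subseteq> euclid d"
    using clust by (auto simp: clusterings_def)
  have finP: "finite P" using P(2) assms(2) card.infinite by fastforce
  obtain h where h: "k \<le> 2 ^ h" "0 < h" "real h \<le> 4 * ln (real k)"
    using log2_bound[OF assms(2)] .
  define S where "S = \<mu> ` P"
  have S: "finite S" "S \<noteq> {}" "card S \<le> k"
    using finP P(2) assms(2) card_image_le[of P \<mu>] by (auto simp: S_def)
  define c where "c x = \<mu> (SOME A. A \<in> P \<and> x \<in> A)" for x
  have c: "c x = \<mu> A" if "A \<in> P" "x \<in> A" for x A
  proof -
    have "(SOME A. A \<in> P \<and> x \<in> A) = A"
      by (rule some_equality) (use that P(1) in \<open>auto simp: partition_on_def disjoint_def\<close>)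
    then show ?thesis by (simp add: c_def)
  qed
  have c_S: "c x \<in> S" if "x \<in> X" for x
    using that c P(1) by (fastforce simp: S_def partition_on_def)
  have cost: "cost d (P, \<mu>) = (\<Sum>x\<in>X. l1_dist d x (c x))"
    by (simp add: cost_def c sum_partition_on[OF X(1) P(1), symmetric])
  define good where "good i \<Theta> H \<longleftrightarrow> finite \<Theta> \<and> (\<forall>\<theta>. 0 \<le> (H \<theta> :: real)) \<and>
    (\<forall>m\<in>S. \<forall>m'\<in>S. m i < m' i \<longrightarrow> (\<exists>\<theta>\<in>\<Theta>. m i \<le> \<theta> \<and> \<theta> < m' i \<and> m' i - m i \<le> H \<theta>)) \<and>
    (\<Sum>\<theta>\<in>\<Theta>. real (card {x \<in> X. (x i \<le> \<theta>) \<noteq> (c x i \<le> \<theta>)}) * H \<theta>)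
      \<le> 8 * real h * (\<Sum>x\<in>X. \<bar>x i - c x i\<bar>)" for i \<Theta> H
  have "\<exists>\<Theta> H. good i \<Theta> H" for i
  proof -
    let ?V = "(\<lambda>m. m i) ` S"
    have card: "card ?V \<le> 2 ^ h" using card_image_le[OF S(1), of "\<lambda>m. m i"] S(3) h(1) by linarith
    obtain \<Theta> :: "real set" and H :: "real \<Rightarrow> real" where "finite \<Theta>" "\<And>\<theta>. 0 \<le> H \<theta>"
      "\<And>a b. a \<in> ?V \<Longrightarrow> b \<in> ?V \<Longrightarrow> a < b \<Longrightarrow> \<exists>\<theta>\<in>\<Theta>. a \<le> \<theta> \<and> \<theta> < b \<and> b - a \<le> H \<theta>"
      "(\<Sum>\<theta>\<in>\<Theta>. real (card {x \<in> X. (x i \<le> \<theta>) \<noteq> (c x i \<le> \<theta>)}) * H \<theta>)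
        \<le> 8 * real h * (\<Sum>x\<in>X. \<bar>x i - c x i\<bar>)"
      by (rule line_thresholds[of X ?V h "\<lambda>x. x i" "\<lambda>x. c x i"]) (use X(1) S h(2) card in auto)
    then show ?thesis by (intro exI[of _ \<Theta>] exI[of _ H]) (simp add: good_def)
  qed
  then obtain \<Theta> H where good: "\<And>i. good i (\<Theta> i) (H i)"
    by metis
  then have fin\<Theta>: "\<And>i. finite (\<Theta> i)" and H0: "\<And>i \<theta>. 0 \<le> H i \<theta>"
    and H_sum: "\<And>i. (\<Sum>\<theta>\<in>\<Theta> i. real (card {x \<in> X. (x i \<le> \<theta>) \<noteq> (c x i \<le> \<theta>)}) * H i \<theta>)
      \<le> 8 * real h * (\<Sum>x\<in>X. \<bar>x i - c x i\<bar>)"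
    unfolding good_def by simp_all
  have H: "\<exists>\<theta>\<in>\<Theta> i. m i \<le> \<theta> \<and> \<theta> < m' i \<and> m' i - m i \<le> H i \<theta>"
    if "m \<in> S" "m' \<in> S" "m i < m' i" for i m m'
    using good[of i] that unfolding good_def by blast
  \<comment> \<open>A point is charged for all chosen thresholds, on all axes, that separate it from
    its centre, whether or not the tree uses them. This makes \<open>b\<close> independent of the
    tree.\<close>
  define b where "b x = real d * (\<Sum>i<d. \<Sum>\<theta> | \<theta> \<in> \<Theta> i \<and> (x i \<le> \<theta>) \<noteq> (c x i \<le> \<theta>). H i \<theta>)" for x
  have b0: "0 \<le> b x" for x
    unfolding b_def using H0 by (intro mult_nonneg_nonneg sum_nonneg) auto
  have H_le_b: "real d * H i \<theta> \<le> b x" if "i < d" "\<theta> \<in> \<Theta> i" "(x i \<le> \<theta>) \<noteq> (c x i \<le> \<theta>)" for i \<theta> x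
  proof -
    have "H i \<theta> \<le> (\<Sum>\<theta> | \<theta> \<in> \<Theta> i \<and> (x i \<le> \<theta>) \<noteq> (c x i \<le> \<theta>). H i \<theta>)"
      using that fin\<Theta>[of i] H0 by (intro member_le_sum) auto
    also have "\<dots> \<le> (\<Sum>i<d. \<Sum>\<theta> | \<theta> \<in> \<Theta> i \<and> (x i \<le> \<theta>) \<noteq> (c x i \<le> \<theta>). H i \<theta>)"
      by (rule member_le_sum[where f = "\<lambda>i. \<Sum>\<theta> | \<theta> \<in> \<Theta> i \<and> (x i \<le> \<theta>) \<noteq> (c x i \<le> \<theta>). H i \<theta>"])
        (use that H0 in \<open>auto intro: sum_nonneg\<close>)
    finally show ?thesis unfolding b_def by (intro mult_left_mono) auto
  qed
  have cut: "\<exists>i<d. \<exists>\<theta>. (\<exists>m\<in>S'. m i \<le> \<theta>) \<and> (\<exists>m\<in>S'. m i > \<theta>) \<and>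
      (\<forall>x\<in>X. c x \<in> S' \<and> (x i \<le> \<theta>) \<noteq> (c x i \<le> \<theta>) \<longrightarrow> (\<forall>m\<in>S'. l1_dist d (c x) m \<le> b x))"
    if S': "S' \<subseteq> S" "2 \<le> card S'" for S'
  proof -
    have fin: "finite S'" using S'(1) S(1) finite_subset by blast
    \<comment> \<open>The maximum of \<open>W\<close> selects the widest axis \<open>i\<close> and
      two extreme centres on it. Every other axis is then at most as wide, which bounds the diameter
      by \<open>d\<close> times \<open>H i \<theta>\<close>.\<close>
    define W where "W = (\<lambda>(i, m, m'). m' i - m i) ` ({..<d} \<times> S' \<times> S' :: (nat \<times> point \<times> point) set)"
    have "\<not> card S' \<le> Suc 0" using S'(2) by simp
    then obtain y z where yz: "y \<in> S'" "z \<in> S'" "y \<noteq> z" using card_le_Suc0_iff_eq[OF fin] by blast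
    then have "y \<in> euclid d" "z \<in> euclid d" using S'(1) P(3) by (auto simp: S_def)
    then have "\<exists>j<d. y j \<noteq> z j"
      using yz(3) PiE_ext[of y "{..<d}" "\<lambda>_. UNIV" z] unfolding euclid_def by blast
    then obtain j where j: "j < d" "y j \<noteq> z j" by blast
    have "finite W" using fin by (simp add: W_def)
    have W: "m' i - m i \<in> W" if "i < d" "m \<in> S'" "m' \<in> S'" for i m m'
      using that by (force simp: W_def)
    then have "W \<noteq> {}" using j yz by blast
    then have "Max W \<in> W" using \<open>finite W\<close> by simp
    then obtain i m m' where im: "i < d" "m \<in> S'" "m' \<in> S'" "m' i - m i = Max W"
      by (auto simp: W_def)
    have wide: "a' j - a j \<le> m' i - m i" if "j < d" "a \<in> S'" "a' \<in> S'" for a a' j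
      using W[OF that] \<open>finite W\<close> im(4) by simp
    then have "m i < m' i" using wide[of j y z] wide[of j z y] j yz by linarith
    then obtain \<theta> where \<theta>: "\<theta> \<in> \<Theta> i" "m i \<le> \<theta>" "\<theta> < m' i" "m' i - m i \<le> H i \<theta>"
      using H[of m m' i] im S'(1) by blast
    have "l1_dist d a a' \<le> real d * H i \<theta>" if "a \<in> S'" "a' \<in> S'" for a a'
    proof -
      have "l1_dist d a a' \<le> (\<Sum>j<d. H i \<theta>)"
        unfolding l1_dist_def
      proof (rule sum_mono)
        fix j assume "j \<in> {..<d}"
        then show "\<bar>a j - a' j\<bar> \<le> H i \<theta>"
          using wide[of j a a'] wide[of j a' a] that \<theta>(4) by auto
      qed
      then show ?thesis by simp
    qed
    then show ?thesis
      using im \<theta> H_le_b[OF im(1) \<theta>(1)] by (meson order_trans)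
  qed
  \<comment> \<open>Groups may share a representative, so \<open>S\<close> can have fewer than
    \<open>k\<close> elements; \<open>card S \<le> k \<le> card X\<close> suffices.\<close>
  have "\<exists>t. cut_tree k d X S c b t"
    by (rule cut_tree_exists) (use X S b0 cut in auto)
  then obtain t where t: "cuts_in_dim d t" "size1 t = k" "partition_on X (leaf_cells t X)"
    "card (leaf_cells t X) = k"
    "\<forall>A\<in>leaf_cells t X. \<exists>m\<in>S. \<forall>x\<in>A. c x \<in> S \<longrightarrow> l1_dist d (c x) m \<le> b x"
    by (auto simp: cut_tree_def)
  obtain \<nu> where \<nu>: "\<And>A. A \<in> leaf_cells t X \<Longrightarrow> \<nu> A \<in> S"
    "\<And>A x. A \<in> leaf_cells t X \<Longrightarrow> x \<in> A \<Longrightarrow> c x \<in> S \<Longrightarrow> l1_dist d (c x) (\<nu> A) \<le> b x"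
    using bchoice[OF t(5)[unfolded Bex_def]] by blast
  let ?C = "(leaf_cells t X, \<nu>)"
  have "?C \<in> clusterings k d X"
    using t \<nu>(1) P(3) by (auto simp: clusterings_def S_def)
  moreover have "explainable k d X (fst ?C)"
    using t by (auto simp: explainable_def)
  moreover have "cost d ?C \<le> 36 * real d * ln (real k) * cost d (P, \<mu>)"
  proof -
    have "cost d ?C \<le> (\<Sum>A\<in>leaf_cells t X. \<Sum>x\<in>A. l1_dist d x (c x) + b x)"
      unfolding cost_def prod.case
    proof (intro sum_mono)
      fix A x assume A: "A \<in> leaf_cells t X" "x \<in> A"
      then have "x \<in> X" using t(3) by (auto simp: partition_on_def)
      then show "l1_dist d x (\<nu> A) \<le> l1_dist d x (c x) + b x"
        using \<nu>(2)[OF A] c_S l1_dist_triangle[of d x "\<nu> A" "c x"] by fastforce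
    qed
    also have "\<dots> = (\<Sum>x\<in>X. l1_dist d x (c x) + b x)" by (rule sum_partition_on[OF X(1) t(3)])
    also have "\<dots> = cost d (P, \<mu>) + (\<Sum>x\<in>X. b x)" by (simp add: sum.distrib cost)
    finally have le: "cost d ?C \<le> cost d (P, \<mu>) + (\<Sum>x\<in>X. b x)" .
    \<comment> \<open>Each threshold is charged once by every point that it separates.\<close>
    have swap: "(\<Sum>x\<in>X. \<Sum>\<theta> | \<theta> \<in> \<Theta> i \<and> (x i \<le> \<theta>) \<noteq> (c x i \<le> \<theta>). H i \<theta>)
        = (\<Sum>\<theta>\<in>\<Theta> i. real (card {x \<in> X. (x i \<le> \<theta>) \<noteq> (c x i \<le> \<theta>)}) * H i \<theta>)" for i
      by (subst sum.swap_restrict[OF X(1) fin\<Theta>]) simp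
    have "(\<Sum>x\<in>X. b x) = real d * (\<Sum>i<d. \<Sum>x\<in>X. \<Sum>\<theta> | \<theta> \<in> \<Theta> i \<and> (x i \<le> \<theta>) \<noteq> (c x i \<le> \<theta>). H i \<theta>)"
      unfolding b_def sum_distrib_left[symmetric] by (subst sum.swap) simp
    also have "\<dots> \<le> real d * (\<Sum>i<d. 8 * real h * (\<Sum>x\<in>X. \<bar>x i - c x i\<bar>))"
      unfolding swap by (intro mult_left_mono sum_mono H_sum) auto
    also have "\<dots> = real d * (8 * real h * (\<Sum>x\<in>X. \<Sum>i<d. \<bar>x i - c x i\<bar>))"
      by (subst sum.swap) (simp add: sum_distrib_left)
    also have "\<dots> = 8 * real d * real h * cost d (P, \<mu>)" by (simp add: cost l1_dist_def)
    finally have "cost d ?C \<le> (1 + 8 * (real d * real h)) * cost d (P, \<mu>)"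
      using le by (simp add: algebra_simps)
    also have "\<dots> \<le> 36 * real d * ln (real k) * cost d (P, \<mu>)"
    proof (rule mult_right_mono)
      \<comment> \<open>The original cost is absorbed:
        \<open>1 + 8 * d * h \<le> 9 * d * h \<le> 36 * d * ln k\<close>.\<close>
      have "1 * 1 \<le> real d * real h" using assms(3) h(2) by (intro mult_mono) auto
      moreover have "real d * real h \<le> real d * (4 * ln (real k))" using h(3) by (intro mult_left_mono) auto
      ultimately show "1 + 8 * (real d * real h) \<le> 36 * real d * ln (real k)" by (simp add: mult_ac)
      show "0 \<le> cost d (P, \<mu>)" by (auto simp: cost l1_dist_def intro!: sum_nonneg)
    qed
    finally show ?thesis .
  qed
  ultimately show ?thesis by blast
qed

theorem theorem3:
  "\<exists>C::real. C > 0 \<and>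
     (\<forall>k d :: nat. k \<ge> 2 \<longrightarrow> d \<ge> 1 \<longrightarrow>
        price_of_explainability k d \<le> ereal (C * real d * ln (real k)))"
proof (intro exI[of _ 36] conjI allI impI)
  fix k d :: nat assume kd: "2 \<le> k" "1 \<le> d"
  define K where "K = 36 * real d * ln (real k)"
  have K: "0 < K" using kd by (simp add: K_def)
  have "opt_exp k d X / opt_unr k d X \<le> ereal K"
    if inst: "kmedians_instance k d X" and pos: "0 < opt_unr k d X" for X
  proof -
    have le: "opt_exp k d X \<le> ereal K * ereal (cost d C)" if C: "C \<in> clusterings k d X" for C
    proof -
      obtain C' where C': "C' \<in> clusterings k d X" "explainable k d X (fst C')"
        "cost d C' \<le> K * cost d C"
        using explainable_clustering_exists[OF inst kd, of "fst C" "snd C"] C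
        unfolding K_def prod.collapse by blast
      then have "opt_exp k d X \<le> ereal (cost d C')" unfolding opt_exp_def by (auto intro: INF_lower)
      then show ?thesis using C'(3) by (simp add: order_trans)
    qed
    show ?thesis
    proof (cases "opt_unr k d X")
      case (real r)
      \<comment> \<open>With \<open>K\<close> on the left, the bound can be checked against each
        clustering in the infimum.\<close>
      have "opt_exp k d X / ereal K \<le> opt_unr k d X"
        unfolding opt_unr_def
      proof (rule INF_greatest)
        fix C assume "C \<in> clusterings k d X"
        from le[OF this] show "opt_exp k d X / ereal K \<le> ereal (cost d C)"
          using K by (intro ereal_divide_le_pos[THEN iffD2]) (auto simp: mult.commute)
      qed
      then have "opt_exp k d X \<le> ereal K * ereal r"
        using K real ereal_divide_le_pos[of K "opt_exp k d X" "ereal r"] by simp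
      then show ?thesis
        using pos real by (simp add: ereal_divide_le_pos mult.commute)
    next
      \<comment> \<open>Division by infinity gives 0 in \<open>ereal\<close>.\<close>
      case PInf
      then show ?thesis using K by simp
    qed (use pos in simp)
  qed
  then show "price_of_explainability k d \<le> ereal (36 * real d * ln (real k))"
    unfolding price_of_explainability_def K_def by (auto intro!: SUP_least)
qed simp

end
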